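(* For any fixed incentive graph $G$ and synergy graph $\widetilde G$, the dimension of the optimal public signal is nonincreasing as $\beta\ge0$ increases.
   Context: Model. There are one principal and $n$ agents. Agent $i$ chooses $a_i\in\mathbb R$; $\mathbf a=(a_1,\dots,a_n)'$. The state $\mathbf x=(x_1,\dots,x_n)'$ is distributed as $N(\mu\mathbf 1_n,\sigma^2 I_n)$, with $\mu\in\mathbb R$, $\sigma^2>0$, $\mathbf 1_n$ the vector of ones. The incentive graph $G=[g_{ij}]$ and the synergy graph $\widetilde G=[\tilde g_{ij}]$ are symmetric $n\times n$ matrices with entries in $\{0,1\}$ and zero diagonal; $\beta\ge0$ is a parameter. Agent $i$'s payoff is $u_i(\mathbf a,\mathbf x)=-(a_i-x_i)^2-\beta\sum_{j} g_{ij}(a_i-a_j)^2$; the principal's payoff is $v(\mathbf a,\mathbf x)=-\sum_i (a_i-x_i)^2-\beta\sum_i\sum_j\tilde g_{ij}(a_i-a_j)^2$. A public signal is a map (Markov kernel) $\varphi:\mathbb R^n\to\Delta(M)$, $M$ a measurable space. All agents observe the realization $m$ and nothing else, form $\hat{\mathbf x}=\mathbb E[\mathbf x\mid m]$, and play the unique Nash equilibrium $\mathbf a^*=B\hat{\mathbf x}$, $B=(I_n+\beta L)^{-1}$, where $L=D_G-G$ and $\widetilde L=D_{\widetilde G}-\widetilde G$ are the graph Laplacians ($D$ the diagonal degree matrix). Then $\mathbb E[v(\mathbf a^*,\mathbf x)]=-\mathbb E[\mathbf x'\mathbf x]+\mathbb E[\hat{\mathbf x}'V\hat{\mathbf x}]$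 with $V=B'(I_n-2\beta(\widetilde L-L))B$ (both $B$ and $V$ depend on $\beta$). A signal is optimal if it maximizes $\mathbb E[v(\mathbf a^*,\mathbf x)]$ (equivalently $\mathbb E[\hat{\mathbf x}'V\hat{\mathbf x}]$) over all public signals. By a known theorem, if $\mathbf z_1,\dots,\mathbf z_n$ is an orthonormal eigenbasis of the symmetric matrix $V$ with eigenvalues $\omega_1,\dots,\omega_n$, then the signal disclosing exactly the statistics $\mathbf z_j'\mathbf x$ for all $j$ with $\omega_j\ge0$ is optimal; "the optimal public signal" denotes this signal. Its dimension is the number of disclosed statistics, i.e. the number of nonnegative eigenvalues of $V$ counted with multiplicity. *)

theory Defs
  imports "HOL-Analysis.Analysis"
begin

definition graph_matrix :: "real^'n^'n \<Rightarrow> bool" where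
  "graph_matrix G \<longleftrightarrow>
     transpose G = G \<and> (\<forall>i j. G $ i $ j \<in> {0, 1}) \<and> (\<forall>i. G $ i $ i = 0)"

definition degree_matrix :: "real^'n^'n \<Rightarrow> real^'n^'n" where
  "degree_matrix G = (\<chi> i j. if i = j then (\<Sum>k\<in>UNIV. G $ i $ k) else 0)"

definition laplacian :: "real^'n^'n \<Rightarrow> real^'n^'n" where
  "laplacian G = degree_matrix G - G"

text \<open>The matrix \<open>B\<close> of the unique Nash equilibrium \<open>a = B *v E[x | m]\<close>. The Laplacian is
  positive semidefinite, so the inverse is a genuine one for \<open>\<beta> \<ge> 0\<close>.\<close>
definition equilibrium_matrix :: "real^'n^'n \<Rightarrow> real \<Rightarrow> real^'n^'n" where
  "equilibrium_matrix G \<beta> = matrix_inv (mat 1 + \<beta> *\<^sub>R laplacian G)"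

text \<open>The matrix \<open>V\<close> for which the principal's expected payoff from a public signal is
  \<open>- E[x \<bullet> x] + E[y \<bullet> (V *v y)]\<close>, where \<open>y = E[x | m]\<close>;
  \<open>G\<close> is the incentive graph and \<open>H\<close> the synergy graph.\<close>
definition payoff_matrix :: "real^'n^'n \<Rightarrow> real^'n^'n \<Rightarrow> real \<Rightarrow> real^'n^'n" where
  "payoff_matrix G H \<beta> =
     transpose (equilibrium_matrix G \<beta>)
       ** (mat 1 - (2 * \<beta>) *\<^sub>R (laplacian H - laplacian G))
       ** equilibrium_matrix G \<beta>"

definition orthonormal_eigenbasis ::
    "real^'n^'n \<Rightarrow> ('n \<Rightarrow> real^'n) \<Rightarrow> ('n \<Rightarrow> real) \<Rightarrow> bool" where
  "orthonormal_eigenbasis A z \<omega> \<longleftrightarrow>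
     (\<forall>i j. z i \<bullet> z j = (if i = j then 1 else 0)) \<and>
     (\<forall>j. A *v z j = \<omega> j *\<^sub>R z j)"

text \<open>A set \<open>W\<close> of vectors stands for the public signal that discloses exactly the statistics
  \<open>w \<bullet> x\<close> of the state \<open>x\<close>, for \<open>w \<in> W\<close>. The optimal public signal is determined only up to
  the choice of an orthonormal eigenbasis of \<open>V\<close>, so it is a predicate on \<open>W\<close>.
  Eigenvalue zero counts as disclosed.\<close>
definition optimal_public_signal ::
    "real^'n^'n \<Rightarrow> real^'n^'n \<Rightarrow> real \<Rightarrow> (real^'n) set \<Rightarrow> bool" where
  "optimal_public_signal G H \<beta> W \<longleftrightarrow>
     (\<exists>z \<omega>. orthonormal_eigenbasis (payoff_matrix G H \<beta>) z \<omega> \<and> W = {z j | j. \<omega> j \<ge> 0})"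

definition signal_dimension :: "(real^'n) set \<Rightarrow> nat" where
  "signal_dimension W = card W"

end

theory Submission
  imports Defs
begin

text \<open>Put \<open>M \<beta> = I - 2 \<beta> (L\<^sub>H - L\<^sub>G)\<close>. Since \<open>V = B\<^sup>T M B\<close> with \<open>B\<close> invertible, Sylvester's law of
  inertia reduces the claim to \<open>M\<close>, and for \<open>0 \<le> \<beta>\<^sub>1 \<le> \<beta>\<^sub>2\<close> the matrix \<open>M \<beta>\<^sub>1\<close> is a convex combination
  of \<open>I\<close> and \<open>M \<beta>\<^sub>2\<close>. Hence \<open>M \<beta>\<^sub>1\<close> is nonnegative on every subspace where \<open>M \<beta>\<^sub>2\<close> is, and such a
  subspace meets the subspace on which \<open>M \<beta>\<^sub>1\<close> is negative definite only in \<open>0\<close>.\<close>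

lemma laplacian_mult_nth:
  "(laplacian G *v x) $ i = (\<Sum>k\<in>UNIV. G $ i $ k * (x $ i - x $ k))"
proof -
  have "(laplacian G *v x) $ i
      = (\<Sum>k\<in>UNIV. (if i = k then (\<Sum>l\<in>UNIV. G $ i $ l) * x $ k else 0) - G $ i $ k * x $ k)"
    unfolding laplacian_def degree_matrix_def matrix_vector_mult_def
    by (auto simp: left_diff_distrib intro!: sum.cong)
  also have "\<dots> = (\<Sum>k\<in>UNIV. G $ i $ k * (x $ i - x $ k))"
    by (simp add: sum_subtractf right_diff_distrib sum_distrib_right)
  finally show ?thesis .
qed

text \<open>Since \<open>G\<close> is symmetric, exchanging the two summation indices does not
  change the quadratic form. Adding the two versions turns twice the form into a sum of squares with
  the nonnegative weights \<open>G $ i $ k\<close>.\<close>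

lemma laplacian_psd:
  assumes "graph_matrix G"
  shows "0 \<le> x \<bullet> (laplacian G *v x)"
proof -
  have sym: "G $ i $ k = G $ k $ i" for i k
    using assms unfolding graph_matrix_def by (metis transpose_def vec_lambda_beta)
  have nonneg: "0 \<le> G $ i $ k" for i k
  proof -
    have "G $ i $ k \<in> {0, 1}" using assms unfolding graph_matrix_def by blast
    then show ?thesis by auto
  qed
  let ?q = "\<Sum>i\<in>UNIV. \<Sum>k\<in>UNIV. G $ i $ k * (x $ i * (x $ i - x $ k))"
  have q: "x \<bullet> (laplacian G *v x) = ?q"
    by (simp add: inner_vec_def laplacian_mult_nth sum_distrib_left algebra_simps)
  have "?q = (\<Sum>i\<in>UNIV. \<Sum>k\<in>UNIV. G $ i $ k * (x $ k * (x $ k - x $ i)))"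
    by (subst sum.swap) (simp add: sym)
  then have "2 * ?q = (\<Sum>i\<in>UNIV. \<Sum>k\<in>UNIV. G $ i $ k * (x $ i * (x $ i - x $ k))
      + G $ i $ k * (x $ k * (x $ k - x $ i)))"
    by (simp add: sum.distrib)
  also have "\<dots> = (\<Sum>i\<in>UNIV. \<Sum>k\<in>UNIV. G $ i $ k * (x $ i - x $ k)\<^sup>2)"
    by (simp add: power2_eq_square algebra_simps)
  also have "\<dots> \<ge> 0"
    by (intro sum_nonneg mult_nonneg_nonneg nonneg) auto
  finally show ?thesis using q by simp
qed

text \<open>\<open>matrix_inv\<close> is defined by choice, so invertibility of I + \<beta> L has to
  come first. It holds because the form of this matrix is at least \<open>x \<bullet> x\<close>,
  which makes the kernel trivial. Injectivity later ensures that \<open>equilibrium_matrix\<close>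
  preserves dimensions of subspaces.\<close>

lemma inj_equilibrium_matrix:
  assumes "graph_matrix G" and "0 \<le> \<beta>"
  shows "inj ((*v) (equilibrium_matrix G \<beta>))"
proof -
  let ?A = "mat 1 + \<beta> *\<^sub>R laplacian G"
  have "x = 0" if "?A *v x = 0" for x
  proof -
    have "0 = x \<bullet> (?A *v x)" using that by simp
    also have "\<dots> = x \<bullet> x + \<beta> * (x \<bullet> (laplacian G *v x))"
      by (simp add: matrix_vector_mult_add_rdistrib scaleR_matrix_vector_assoc [symmetric]
          inner_add_right)
    finally have "x \<bullet> x \<le> 0"
      using mult_nonneg_nonneg [OF assms(2) laplacian_psd [OF assms(1), of x]] by linarith
    then show ?thesis by (metis inner_eq_zero_iff inner_ge_zero antisym)
  qed
  then have "invertible ?A"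
    by (auto simp: invertible_left_inverse matrix_left_invertible_ker)
  then have "?A ** equilibrium_matrix G \<beta> = mat 1"
    unfolding equilibrium_matrix_def matrix_inv_def invertible_def by (rule someI2_ex) simp
  then show ?thesis
    using matrix_left_invertible_injective by blast
qed

text \<open>This is the congruence behind the law of inertia: the sign of the form of V at
  \<open>x\<close> is the sign of the form of M at the image of \<open>x\<close>.\<close>

lemma inner_payoff_matrix:
  fixes x :: "real^'n"
  shows "x \<bullet> (payoff_matrix G H \<beta> *v x)
    = (equilibrium_matrix G \<beta> *v x) \<bullet>
        ((mat 1 - (2 * \<beta>) *\<^sub>R (laplacian H - laplacian G)) *v (equilibrium_matrix G \<beta> *v x))"
proof -
  have adjoint: "x \<bullet> (v v* B) = (B *v x) \<bullet> v" for v :: "real^'n" and B :: "real^'n^'n"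
    by (metis dot_lmul_matrix inner_commute)
  show ?thesis
    unfolding payoff_matrix_def matrix_vector_mul_assoc [symmetric] transpose_matrix_vector
    by (rule adjoint)
qed

lemma orthonormal_eigenbasis_inj:
  assumes "orthonormal_eigenbasis A z \<omega>"
  shows "inj z"
  using assms unfolding orthonormal_eigenbasis_def by (metis injI zero_neq_one)

lemma orthonormal_eigenbasis_dim:
  assumes "orthonormal_eigenbasis A z \<omega>"
  shows "dim (span (z ` J)) = card J"
proof -
  have "pairwise orthogonal (z ` J)"
    using assms unfolding orthonormal_eigenbasis_def pairwise_def orthogonal_def by auto
  moreover have "0 \<notin> z ` J"
    using assms unfolding orthonormal_eigenbasis_def by (metis imageE inner_zero_left zero_neq_one)
  ultimately have "independent (z ` J)" by (rule pairwise_orthogonal_independent)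
  then have "dim (span (z ` J)) = card (z ` J)"
    by (simp add: dim_eq_card_independent)
  also have "\<dots> = card J"
    using orthonormal_eigenbasis_inj [OF assms] by (meson card_image inj_on_subset subset_UNIV)
  finally show ?thesis .
qed

text \<open>Orthonormality kills the cross terms, so on the span of selected eigenvectors the sign
  of the form is governed by the selected eigenvalues alone.\<close>

lemma orthonormal_eigenbasis_quadratic_form:
  fixes A :: "real^'n^'n"
  assumes "orthonormal_eigenbasis A z \<omega>" and "x \<in> span (z ` J)"
  obtains u where "x = (\<Sum>j\<in>J. u j *\<^sub>R z j)" and "x \<bullet> (A *v x) = (\<Sum>j\<in>J. \<omega> j * (u j)\<^sup>2)"
proof -
  have inj: "inj_on z J"
    using orthonormal_eigenbasis_inj [OF assms(1)] by (rule inj_on_subset) simp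
  obtain v where "x = (\<Sum>w\<in>z ` J. v w *\<^sub>R w)"
    using assms(2) by (auto simp: span_finite)
  then have x: "x = (\<Sum>j\<in>J. v (z j) *\<^sub>R z j)"
    by (simp add: sum.reindex [OF inj])
  have z: "z i \<bullet> z j = (if i = j then 1 else 0)" and ev: "A *v z j = \<omega> j *\<^sub>R z j" for i j
    using assms(1) unfolding orthonormal_eigenbasis_def by auto
  have Ax: "A *v x = (\<Sum>j\<in>J. (v (z j) * \<omega> j) *\<^sub>R z j)"
    unfolding x by (simp add: linear_sum [OF matrix_vector_mul_linear] matrix_vector_mult_scaleR ev)
  have "x \<bullet> (A *v x) = (\<Sum>j\<in>J. \<omega> j * (v (z j))\<^sup>2)"
    unfolding Ax
    by (subst x) (simp add: inner_sum_left inner_sum_right z if_distrib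
        power2_eq_square mult_ac cong: if_cong)
  then show thesis using x by (rule that [rotated])
qed

theorem proposition5:
  fixes G H :: "real^'n^'n" and \<beta>\<^sub>1 \<beta>\<^sub>2 :: real and W\<^sub>1 W\<^sub>2 :: "(real^'n) set"
  assumes "graph_matrix G" and "graph_matrix H"
    and "0 \<le> \<beta>\<^sub>1" and "\<beta>\<^sub>1 \<le> \<beta>\<^sub>2"
    and "optimal_public_signal G H \<beta>\<^sub>1 W\<^sub>1"
    and "optimal_public_signal G H \<beta>\<^sub>2 W\<^sub>2"
  shows "signal_dimension W\<^sub>2 \<le> signal_dimension W\<^sub>1"
proof -
  obtain z \<omega> where z: "orthonormal_eigenbasis (payoff_matrix G H \<beta>\<^sub>1) z \<omega>"
    and "W\<^sub>1 = {z j | j. \<omega> j \<ge> 0}"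
    using assms(5) unfolding optimal_public_signal_def by blast
  \<comment> \<open>Distinct indices give distinct eigenvectors, so the cardinality of the set
    counts eigenvalues with multiplicity.\<close>
  then have W1: "card W\<^sub>1 = card {j. \<omega> j \<ge> 0}"
    using orthonormal_eigenbasis_inj [OF z]
    by (simp add: card_image inj_on_subset flip: image_Collect)
  obtain y \<theta> where y: "orthonormal_eigenbasis (payoff_matrix G H \<beta>\<^sub>2) y \<theta>"
    and "W\<^sub>2 = {y j | j. \<theta> j \<ge> 0}"
    using assms(6) unfolding optimal_public_signal_def by blast
  then have W2: "card W\<^sub>2 = card {j. \<theta> j \<ge> 0}"
    using orthonormal_eigenbasis_inj [OF y]
    by (simp add: card_image inj_on_subset flip: image_Collect)
  let ?K = "laplacian H - laplacian G"
  let ?M = "\<lambda>\<beta>. mat 1 - (2 * \<beta>) *\<^sub>R ?K"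
  let ?B = "equilibrium_matrix G"
  \<comment> \<open>Zero eigenvalues belong to \<open>T\<close> but not to \<open>S\<close>, in line
    with the convention that they are disclosed: n minus the dimension of \<open>S\<close> is then
    exactly the first signal dimension.\<close>
  define S where "S = span (z ` {j. \<omega> j < 0})"
  define T where "T = span (y ` {j. \<theta> j \<ge> 0})"
  have form: "x \<bullet> (?M \<beta> *v x) = x \<bullet> x - 2 * \<beta> * (x \<bullet> (?K *v x))" for x \<beta>
    by (simp add: matrix_vector_mult_diff_rdistrib scaleR_matrix_vector_assoc [symmetric]
        inner_diff_right)
  \<comment> \<open>A split on the sign of the form of \<open>?K\<close> avoids dividing by
    \<open>\<beta>\<^sub>2\<close>: if it is at most 0, the form of \<open>?M\<close> is at least
    \<open>x \<bullet> x\<close> for every \<beta> \<ge> 0; otherwise the form decreases in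
    \<beta>.\<close>
  have mono: "0 \<le> x \<bullet> (?M \<beta>\<^sub>1 *v x)" if "0 \<le> x \<bullet> (?M \<beta>\<^sub>2 *v x)" for x
  proof (cases "x \<bullet> (?K *v x) \<le> 0")
    case True
    then have "\<beta>\<^sub>1 * (x \<bullet> (?K *v x)) \<le> 0"
      using assms(3) by (simp add: mult_nonneg_nonpos)
    then show ?thesis unfolding form using inner_ge_zero [of x] by linarith
  next
    case False
    then have "\<beta>\<^sub>1 * (x \<bullet> (?K *v x)) \<le> \<beta>\<^sub>2 * (x \<bullet> (?K *v x))"
      using assms(4) by (simp add: mult_right_mono)
    then show ?thesis using that unfolding form by linarith
  qed
  have neg: "x = 0" if x_S: "x \<in> S" and "0 \<le> x \<bullet> (payoff_matrix G H \<beta>\<^sub>1 *v x)" for x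
  proof -
    obtain u where x: "x = (\<Sum>j | \<omega> j < 0. u j *\<^sub>R z j)"
      and q: "x \<bullet> (payoff_matrix G H \<beta>\<^sub>1 *v x) = (\<Sum>j | \<omega> j < 0. \<omega> j * (u j)\<^sup>2)"
      using x_S unfolding S_def by (rule orthonormal_eigenbasis_quadratic_form [OF z])
    \<comment> \<open>All terms are nonpositive while their sum is nonnegative, so each vanishes;
      the sign is flipped to fit \<open>sum_nonneg_eq_0_iff\<close>.\<close>
    have "(\<Sum>j | \<omega> j < 0. - (\<omega> j * (u j)\<^sup>2)) = 0"
      using that(2) sum_nonpos [of "{j. \<omega> j < 0}" "\<lambda>j. \<omega> j * (u j)\<^sup>2"] unfolding q
      by (simp add: sum_negf mult_nonpos_nonneg antisym)
    then have "\<forall>j\<in>{j. \<omega> j < 0}. - (\<omega> j * (u j)\<^sup>2) = 0"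
      by (subst (asm) sum_nonneg_eq_0_iff) (auto simp: mult_nonpos_nonneg)
    then have "u j = 0" if "\<omega> j < 0" for j using that by force
    then show ?thesis unfolding x by simp
  qed
  have nonneg: "0 \<le> x \<bullet> (payoff_matrix G H \<beta>\<^sub>2 *v x)" if x: "x \<in> T" for x
  proof -
    obtain u where "x \<bullet> (payoff_matrix G H \<beta>\<^sub>2 *v x) = (\<Sum>j | \<theta> j \<ge> 0. \<theta> j * (u j)\<^sup>2)"
      using x unfolding T_def by (rule orthonormal_eigenbasis_quadratic_form [OF y])
    then show ?thesis by (auto intro!: sum_nonneg)
  qed
  \<comment> \<open>\<open>S\<close> and \<open>T\<close> come from different matrices V, congruent
    to M through different \<open>?B\<close>. Their images lie in the common space where
    \<open>mono\<close> compares the two forms.\<close>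
  let ?S = "(*v) (?B \<beta>\<^sub>1) ` S" and ?T = "(*v) (?B \<beta>\<^sub>2) ` T"
  have "?S \<inter> ?T \<subseteq> {0}"
  proof
    fix v assume "v \<in> ?S \<inter> ?T"
    then obtain s t where s: "s \<in> S" "v = ?B \<beta>\<^sub>1 *v s" and t: "t \<in> T" "v = ?B \<beta>\<^sub>2 *v t"
      by blast
    have "0 \<le> v \<bullet> (?M \<beta>\<^sub>2 *v v)"
      using nonneg [OF t(1)] t(2) by (simp add: inner_payoff_matrix)
    then have "0 \<le> s \<bullet> (payoff_matrix G H \<beta>\<^sub>1 *v s)"
      using mono s(2) by (simp add: inner_payoff_matrix)
    then show "v \<in> {0}" using neg [OF s(1)] s(2) by simp
  qed
  then have "dim (?S \<inter> ?T) = 0" by (simp add: dim_eq_0)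
  moreover have "subspace ?S" "subspace ?T"
    unfolding S_def T_def by (simp_all add: linear_subspace_image matrix_vector_mul_linear)
  \<comment> \<open>The sum of the two subspaces is direct, so their dimensions add up to at most
    n.\<close>
  ultimately have "dim ?S + dim ?T = dim {v + w | v w. v \<in> ?S \<and> w \<in> ?T}"
    using dim_sums_Int [of ?S ?T] by linarith
  also have "\<dots> \<le> CARD('n)"
    by (rule dim_subset_UNIV_cart)
  finally have "dim ?S + dim ?T \<le> CARD('n)" .
  moreover have "dim ?S = card {j. \<omega> j < 0}"
  proof -
    have "dim ?S = dim S"
      using inj_equilibrium_matrix [OF assms(1,3)]
      by (intro dim_image_eq matrix_vector_mul_linear) (rule inj_on_subset, auto)
    then show ?thesis unfolding S_def orthonormal_eigenbasis_dim [OF z] .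
  qed
  moreover have "dim ?T = card {j. \<theta> j \<ge> 0}"
  proof -
    have "dim ?T = dim T"
      using inj_equilibrium_matrix [OF assms(1) order_trans [OF assms(3,4)]]
      by (intro dim_image_eq matrix_vector_mul_linear) (rule inj_on_subset, auto)
    then show ?thesis unfolding T_def orthonormal_eigenbasis_dim [OF y] .
  qed
  moreover have "card {j. \<omega> j \<ge> 0} + card {j. \<omega> j < 0} = CARD('n)"
  proof -
    have "{j. \<omega> j \<ge> 0} \<union> {j. \<omega> j < 0} = UNIV" by auto
    then show ?thesis by (subst card_Un_disjoint [symmetric]) auto
  qed
  ultimately show ?thesis
    unfolding signal_dimension_def W1 W2 by linarith
qed

end
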